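(* Let $f:\mathbb{R}^d\to\mathbb{R}$ be weakly differentiable with respect to each $x_j$, $j=1,\dots,d$, and let $\mathrm{grad}(f)(\mathbf{X})$ have finite second-order moments. For the importance measure $$d\eta(u):=\sum_{k\in u}\mathbb{E}\big[(e_k^T\mathrm{grad}(f)(\mathbf{X}))^2\big]+\sum_{\{k_1,k_2\}\subseteq u}\mathbb{E}\big[\big|e_{k_1}^T\mathrm{grad}(f)(\mathbf{X})\;e_{k_2}^T\mathrm{grad}(f)(\mathbf{X})\big|\big],\qquad u\subseteq\{1,\dots,d\},$$ (the second sum being over unordered pairs of distinct indices), the unique Shapley values of the inputs $X_j$, $j=1,\dots,d$, are $$d\Phi_j=\mathbb{E}\big[(e_j^T\mathrm{grad}(f)(\mathbf{X}))^2\big]+\frac12\sum_{\substack{k=1\\k\ne j}}^d\mathbb{E}\big[\big|e_j^T\mathrm{grad}(f)(\mathbf{X})\;e_k^T\mathrm{grad}(f)(\mathbf{X})\big|\big].$$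
   Context: $\mathbf{X}=(X_1,\dots,X_d)$ is a random vector of (possibly dependent) continuous variables. For each $j$, a dependency model $\mathbf{X}_{\sim j}\stackrel{d}{=}r_j(X_j,\mathbf{Z}_{\sim j})$ is given, where $\mathbf{X}_{\sim j}$ is $\mathbf{X}$ without its $j$-th entry, $r_j:\mathbb{R}^d\to\mathbb{R}^{d-1}$ has components $r_{i,j}$ ($i\ne j$), $\mathbf{Z}_{\sim j}$ is a random vector independent of $X_j$, and $r_j$ is invertible in its second argument, with inverse $\mathbf{Z}_{\sim j}=r_j^{-1}(\mathbf{X}_{\sim j}\mid X_j)$. Let $J^{(j)}(\mathbf{x})\in\mathbb{R}^d$ be the column vector whose $j$-th entry is $1$ and whose $i$-th entry ($i\ne j$) is $\frac{\partial r_{i,j}}{\partial x_j}$ evaluated at $(x_j,\,r_j^{-1}(\mathbf{x}_{\sim j}\mid x_j))$; put $J^d(\mathbf{x})=[J^{(1)}(\mathbf{x}),\dots,J^{(d)}(\mathbf{x})]$ and $G(\mathbf{x})=J^d(\mathbf{x})^T J^d(\mathbf{x})$, and let $G^{-1}(\mathbf{x})$ be its (generalized) inverse. The gradient is $\mathrm{grad}(f)(\mathbf{x}):=G^{-1}(\mathbf{x})\nabla f(\mathbf{x})$, with $\nabla f$ the vector of weak partial derivatives. $e_k$ is the $k$-th canonical basis vector of $\mathbb{R}^d$. With $D=\{1,\dots,d\}$, for a map $\eta$ from the subsets of $D$ to $\mathbb{R}_+$ with $\eta(\emptyset)=0$, the Shapley values associated with $\eta$ are $$\Phi_j=\frac1d\sum_{v\subseteq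 D\setminus\{j\}}\binom{d-1}{|v|}^{-1}\big[\eta(v\cup\{j\})-\eta(v)\big],\qquad j=1,\dots,d.$$ *)

theory Defs
  imports "HOL-Probability.Probability"
begin

text \<open>Vectors are indexed by a finite type \<^typ>\<open>'n\<close>, so that \<open>d = CARD('n)\<close> and \<open>D = UNIV\<close>.\<close>

section \<open>Weak differentiability\<close>

definition partial_deriv :: "'n::finite \<Rightarrow> (real^'n \<Rightarrow> real) \<Rightarrow> real^'n \<Rightarrow> real" where
  "partial_deriv j f x = deriv (\<lambda>t. f (x + t *\<^sub>R axis j 1)) 0"

primrec C_k :: "nat \<Rightarrow> (real^'n::finite \<Rightarrow> real) \<Rightarrow> bool" where
  "C_k 0 f \<longleftrightarrow> continuous_on UNIV f"
| "C_k (Suc k) f \<longleftrightarrow> (\<forall>x. f differentiable (at x)) \<and> (\<forall>j. C_k k (partial_deriv j f))"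

definition test_function :: "(real^'n::finite \<Rightarrow> real) \<Rightarrow> bool" where
  "test_function \<phi> \<longleftrightarrow> (\<forall>k. C_k k \<phi>) \<and> compact (closure {x. \<phi> x \<noteq> 0})"

definition locally_integrable :: "(real^'n::finite \<Rightarrow> real) \<Rightarrow> bool" where
  "locally_integrable f \<longleftrightarrow> (\<forall>K. compact K \<longrightarrow> set_integrable lebesgue K f)"

definition weak_partial_deriv ::
    "'n::finite \<Rightarrow> (real^'n \<Rightarrow> real) \<Rightarrow> (real^'n \<Rightarrow> real) \<Rightarrow> bool" where
  "weak_partial_deriv j f g \<longleftrightarrow> locally_integrable f \<and> locally_integrable g \<and>
     (\<forall>\<phi>. test_function \<phi> \<longrightarrow>
        (LINT x|lebesgue. f x * partial_deriv j \<phi> x) = - (LINT x|lebesgue. g x * \<phi> x))"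

text \<open>Weak derivatives are unique only up to null sets; \<open>Df\<close> is one representative.\<close>

definition weak_gradient :: "(real^'n::finite \<Rightarrow> real) \<Rightarrow> (real^'n \<Rightarrow> real^'n) \<Rightarrow> bool" where
  "weak_gradient f Df \<longleftrightarrow> (\<forall>j. weak_partial_deriv j f (\<lambda>x. Df x $ j))"

section \<open>Dependency models\<close>

text \<open>A subvector \<open>x\<^sub>I\<close> is an extensional function on \<open>I\<close>. In particular
  \<open>subvec (- {j}) x\<close> is \<open>x\<close> without its \<open>j\<close>-th entry, and \<open>\<real>\<^bsup>d-1\<^esup>\<close>, with entries
  labelled by the \<open>i \<noteq> j\<close>, is the space of \<open>borel_on (- {j})\<close>.\<close>

definition subvec :: "'n::finite set \<Rightarrow> real^'n \<Rightarrow> 'n \<Rightarrow> real" where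
  "subvec I x = (\<lambda>i\<in>I. x $ i)"

abbreviation borel_on :: "'n::finite set \<Rightarrow> ('n \<Rightarrow> real) measure" where
  "borel_on I \<equiv> (\<Pi>\<^sub>M i\<in>I. borel)"

definition continuous_rv :: "'a measure \<Rightarrow> ('a \<Rightarrow> real) \<Rightarrow> bool" where
  "continuous_rv M Y \<longleftrightarrow> Y \<in> borel_measurable M \<and> continuous_on UNIV (cdf (distr M borel Y))"

text \<open>The map \<open>r\<close> takes \<open>x\<^sub>j\<close> and \<open>z \<in> \<real>\<^bsup>d-1\<^esup>\<close>. It is inverted in \<open>z\<close> on a set \<open>S\<close> that
  carries \<open>Z\<close>, because \<open>Z\<close> need not range over all of \<open>\<real>\<^bsup>d-1\<^esup>\<close> (for instance, \<open>Z\<close> may be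
  uniform on the unit cube and \<open>r\<close> a conditional quantile transform);
  \<open>S = space (borel_on (- {j}))\<close> is the case of a globally invertible \<open>r\<close>.\<close>

definition model_inv ::
    "('n \<Rightarrow> real) set \<Rightarrow> (real \<Rightarrow> ('n \<Rightarrow> real) \<Rightarrow> ('n \<Rightarrow> real)) \<Rightarrow> real \<Rightarrow> ('n \<Rightarrow> real) \<Rightarrow> ('n \<Rightarrow> real)"
  where "model_inv S r t = inv_into S (r t)"

text \<open>Independence of \<open>X\<^sub>j\<close> and \<open>Z\<close> is stated for the one-entry subvector \<open>X\<^bsub>{j}\<^esub>\<close>, since
  \<^const>\<open>prob_space.indep_var\<close> needs both variables to have the same type. The last two
  conditions say that the inverse and the derivatives entering the Jacobian exist almost surely.\<close>

definition dependency_model ::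
    "'a measure \<Rightarrow> ('a \<Rightarrow> real^'n::finite) \<Rightarrow> 'n \<Rightarrow> ('a \<Rightarrow> 'n \<Rightarrow> real) \<Rightarrow>
     ('n \<Rightarrow> real) set \<Rightarrow> (real \<Rightarrow> ('n \<Rightarrow> real) \<Rightarrow> ('n \<Rightarrow> real)) \<Rightarrow> bool" where
  "dependency_model M X j Z S r \<longleftrightarrow>
     prob_space.indep_var M (borel_on {j}) (\<lambda>\<omega>. subvec {j} (X \<omega>)) (borel_on (- {j})) Z \<and>
     S \<subseteq> space (borel_on (- {j})) \<and>
     (AE \<omega> in M. Z \<omega> \<in> S) \<and>
     (\<lambda>\<omega>. r (X \<omega> $ j) (Z \<omega>)) \<in> measurable M (borel_on (- {j})) \<and>
     distr M (borel_on (- {j})) (\<lambda>\<omega>. subvec (- {j}) (X \<omega>)) =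
       distr M (borel_on (- {j})) (\<lambda>\<omega>. r (X \<omega> $ j) (Z \<omega>)) \<and>
     (\<forall>t. inj_on (r t) S) \<and>
     (\<lambda>\<omega>. model_inv S r (X \<omega> $ j) (subvec (- {j}) (X \<omega>))) \<in> measurable M (borel_on (- {j})) \<and>
     distr M (borel_on (- {j})) Z =
       distr M (borel_on (- {j})) (\<lambda>\<omega>. model_inv S r (X \<omega> $ j) (subvec (- {j}) (X \<omega>))) \<and>
     (AE \<omega> in M. subvec (- {j}) (X \<omega>) \<in> r (X \<omega> $ j) ` S) \<and>
     (AE \<omega> in M. \<forall>i. i \<noteq> j \<longrightarrow>
        (\<lambda>t. r t (model_inv S r (X \<omega> $ j) (subvec (- {j}) (X \<omega>))) i) differentiable at (X \<omega> $ j))"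

section \<open>Dependent gradient\<close>

definition dep_jacobian_col ::
    "('n \<Rightarrow> ('n \<Rightarrow> real) set) \<Rightarrow> ('n \<Rightarrow> real \<Rightarrow> ('n \<Rightarrow> real) \<Rightarrow> ('n \<Rightarrow> real)) \<Rightarrow>
     'n::finite \<Rightarrow> real^'n \<Rightarrow> real^'n" where
  "dep_jacobian_col S r j x =
     (\<chi> i. if i = j then 1
           else deriv (\<lambda>t. r j t (model_inv (S j) (r j) (x $ j) (subvec (- {j}) x)) i) (x $ j))"

definition dep_jacobian ::
    "('n \<Rightarrow> ('n \<Rightarrow> real) set) \<Rightarrow> ('n \<Rightarrow> real \<Rightarrow> ('n \<Rightarrow> real) \<Rightarrow> ('n \<Rightarrow> real)) \<Rightarrow>
     real^'n::finite \<Rightarrow> real^'n^'n" where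
  "dep_jacobian S r x = (\<chi> i j. dep_jacobian_col S r j x $ i)"

definition metric_tensor ::
    "('n \<Rightarrow> ('n \<Rightarrow> real) set) \<Rightarrow> ('n \<Rightarrow> real \<Rightarrow> ('n \<Rightarrow> real) \<Rightarrow> ('n \<Rightarrow> real)) \<Rightarrow>
     real^'n::finite \<Rightarrow> real^'n^'n" where
  "metric_tensor S r x = transpose (dep_jacobian S r x) ** dep_jacobian S r x"

text \<open>This is the inverse of \<open>A\<close> whenever \<open>A\<close> is invertible; for singular \<open>A\<close> it admits every
  generalized inverse, the Moore--Penrose one included.\<close>

definition generalized_inverse :: "real^'n::finite^'n \<Rightarrow> real^'n^'n \<Rightarrow> bool" where
  "generalized_inverse A B \<longleftrightarrow> A ** B ** A = A"

definition dep_grad ::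
    "(real^'n::finite \<Rightarrow> real^'n^'n) \<Rightarrow> (real^'n \<Rightarrow> real^'n) \<Rightarrow> real^'n \<Rightarrow> real^'n" where
  "dep_grad Ginv Df x = Ginv x *v Df x"

definition finite_second_moments :: "'a measure \<Rightarrow> ('a \<Rightarrow> real^'n::finite) \<Rightarrow> bool" where
  "finite_second_moments M Y \<longleftrightarrow>
     Y \<in> borel_measurable M \<and> (\<forall>k l. integrable M (\<lambda>\<omega>. Y \<omega> $ k * Y \<omega> $ l))"

section \<open>Importance measures and Shapley values\<close>

definition importance_measure :: "('n::finite set \<Rightarrow> real) \<Rightarrow> bool" where
  "importance_measure \<eta> \<longleftrightarrow> \<eta> {} = 0 \<and> (\<forall>u. 0 \<le> \<eta> u)"

definition shapley_value :: "('n::finite set \<Rightarrow> real) \<Rightarrow> 'n \<Rightarrow> real" where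
  "shapley_value \<eta> j =
     1 / real CARD('n) *
     (\<Sum>v\<in>Pow (UNIV - {j}). inverse (real ((CARD('n) - 1) choose card v)) * (\<eta> (v \<union> {j}) - \<eta> v))"

text \<open>Unordered pairs of distinct indices are two-element sets \<open>p\<close>. In the measure below, \<open>Y\<close>
  stands for \<open>grad(f)(X)\<close>.\<close>

definition d_eta :: "'a measure \<Rightarrow> ('a \<Rightarrow> real^'n::finite) \<Rightarrow> 'n set \<Rightarrow> real" where
  "d_eta M Y u =
     (\<Sum>k\<in>u. LINT \<omega>|M. (axis k 1 \<bullet> Y \<omega>)\<^sup>2) +
     (\<Sum>p\<in>{p. p \<subseteq> u \<and> card p = 2}. LINT \<omega>|M. \<bar>\<Prod>k\<in>p. axis k 1 \<bullet> Y \<omega>\<bar>)"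

end

theory Submission imports Defs begin

text \<open>The marginal contribution of \<open>j\<close> to a coalition \<open>v\<close> is the variance-type term of \<open>j\<close> plus the
  sum over \<open>k \<in> v\<close> of the pair term of \<open>{j, k}\<close>. The Shapley weights of the coalitions add up to
  one, and they are invariant under complementation in \<open>D \<setminus> {j}\<close>, so the coalitions containing a
  given \<open>k \<noteq> j\<close> have total weight one half.\<close>

lemma sum_inverse_binomial_Pow:
  assumes "finite A"
  shows "(\<Sum>v\<in>Pow A. inverse (real (card A choose card v))) = real (card A) + 1"
proof -
  have "(\<Sum>v\<in>Pow A. inverse (real (card A choose card v))) =
      (\<Sum>s\<le>card A. \<Sum>v\<in>{v \<in> Pow A. card v = s}. inverse (real (card A choose card v)))"
    using assms by (intro sum.group [symmetric]) (auto simp: card_mono)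
  also have "\<dots> = (\<Sum>s\<le>card A. real (card A choose s) * inverse (real (card A choose s)))"
    using assms by (intro sum.cong refl) (simp add: n_subsets)
  also have "\<dots> = (\<Sum>s\<le>card A. 1)"
    by (intro sum.cong refl) simp
  finally show ?thesis by simp
qed

lemma sum_inverse_binomial_Pow_mem:
  assumes A: "finite A" and k: "k \<in> A"
  shows "(\<Sum>v\<in>{v \<in> Pow A. k \<in> v}. inverse (real (card A choose card v))) = (real (card A) + 1) / 2"
proof -
  let ?w = "\<lambda>v. inverse (real (card A choose card v))"
  have "(\<Sum>v\<in>{v \<in> Pow A. k \<in> v}. ?w v) = (\<Sum>v\<in>{v \<in> Pow A. k \<notin> v}. ?w v)"
  proof (rule sum.reindex_bij_witness [where i = "\<lambda>v. A - v" and j = "\<lambda>v. A - v"])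
    fix v assume "v \<in> {v \<in> Pow A. k \<in> v}"
    then have "v \<subseteq> A" by simp
    then have "card (A - v) = card A - card v" "card v \<le> card A"
      using A by (auto simp: card_Diff_subset finite_subset card_mono)
    then show "?w (A - v) = ?w v"
      by (simp flip: binomial_symmetric)
  qed (use k in auto)
  moreover have "(\<Sum>v\<in>Pow A. ?w v) =
      (\<Sum>v\<in>{v \<in> Pow A. k \<in> v}. ?w v) + (\<Sum>v\<in>{v \<in> Pow A. k \<notin> v}. ?w v)"
    using A by (subst sum.union_disjoint [symmetric]) (auto intro!: sum.cong)
  ultimately show ?thesis
    using sum_inverse_binomial_Pow [OF A] by simp
qed

lemma shapley_value_additive_marginals:
  fixes \<eta> :: "'n::finite set \<Rightarrow> real"
  assumes marginal: "\<And>v. j \<notin> v \<Longrightarrow> \<eta> (insert j v) - \<eta> v = a + (\<Sum>k\<in>v. b k)"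
  shows "shapley_value \<eta> j = a + 1 / 2 * (\<Sum>k\<in>UNIV - {j}. b k)"
proof -
  define A :: "'n set" where "A = UNIV - {j}"
  define w :: "'n set \<Rightarrow> real" where "w v = inverse (real (card A choose card v))" for v
  have card_A: "card A = CARD('n) - 1" by (simp add: A_def)
  then have d: "real (card A) + 1 = real CARD('n)" by (simp add: of_nat_diff)
  have "(\<Sum>v\<in>Pow A. w v * (\<eta> (v \<union> {j}) - \<eta> v)) = (\<Sum>v\<in>Pow A. w v * (a + (\<Sum>k\<in>v. b k)))"
    using marginal by (intro sum.cong refl) (auto simp: A_def)
  also have "\<dots> = (\<Sum>v\<in>Pow A. w v) * a + (\<Sum>v\<in>Pow A. \<Sum>k\<in>v. w v * b k)"
    by (simp add: distrib_left sum.distrib sum_distrib_left sum_distrib_right)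
  also have "(\<Sum>v\<in>Pow A. \<Sum>k\<in>v. w v * b k) = (\<Sum>v\<in>Pow A. \<Sum>k\<in>{k \<in> A. k \<in> v}. w v * b k)"
    by (intro sum.cong refl) auto
  also have "\<dots> = (\<Sum>k\<in>A. \<Sum>v\<in>{v \<in> Pow A. k \<in> v}. w v * b k)"
    by (rule sum.swap_restrict) simp_all
  also have "\<dots> = (\<Sum>k\<in>A. real CARD('n) / 2 * b k)"
    using sum_inverse_binomial_Pow_mem [of A]
    by (intro sum.cong refl) (simp add: w_def d flip: sum_distrib_right)
  also have "(\<Sum>v\<in>Pow A. w v) = real CARD('n)"
    by (simp add: sum_inverse_binomial_Pow w_def d)
  finally have "(\<Sum>v\<in>Pow A. w v * (\<eta> (v \<union> {j}) - \<eta> v)) =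
      real CARD('n) * (a + 1 / 2 * (\<Sum>k\<in>A. b k))"
    by (simp add: distrib_left sum_distrib_left)
  then show ?thesis
    by (simp add: shapley_value_def w_def card_A flip: A_def)
qed

lemma sum_pairs_insert:
  assumes "finite v" and "j \<notin> v"
  shows "(\<Sum>p\<in>{p. p \<subseteq> insert j v \<and> card p = 2}. g p) =
    (\<Sum>p\<in>{p. p \<subseteq> v \<and> card p = 2}. g p) + (\<Sum>k\<in>v. g {j, k})"
proof -
  have "{p. p \<subseteq> insert j v \<and> card p = 2} = {p. p \<subseteq> v \<and> card p = 2} \<union> (\<lambda>k. {j, k}) ` v"
    using assms(2) by (auto simp: card_2_iff subset_insert_iff)
  moreover have "inj_on (\<lambda>k. {j, k}) v"
    by (auto simp: inj_on_def doubleton_eq_iff)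
  moreover have "{p. p \<subseteq> v \<and> card p = 2} \<inter> (\<lambda>k. {j, k}) ` v = {}"
    using assms(2) by auto
  moreover have "finite {p. p \<subseteq> v \<and> card p = 2}"
    using assms(1) by simp
  ultimately show ?thesis
    using assms(1) by (simp add: sum.union_disjoint sum.reindex)
qed

lemma d_eta_insert:
  assumes "j \<notin> v"
  shows "d_eta M Y (insert j v) - d_eta M Y v =
    (LINT \<omega>|M. (axis j 1 \<bullet> Y \<omega>)\<^sup>2) +
    (\<Sum>k\<in>v. LINT \<omega>|M. \<bar>(axis j 1 \<bullet> Y \<omega>) * (axis k 1 \<bullet> Y \<omega>)\<bar>)"
proof -
  have "(\<Sum>k\<in>v. LINT \<omega>|M. \<bar>\<Prod>i\<in>{j, k}. axis i 1 \<bullet> Y \<omega>\<bar>) =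
      (\<Sum>k\<in>v. LINT \<omega>|M. \<bar>(axis j 1 \<bullet> Y \<omega>) * (axis k 1 \<bullet> Y \<omega>)\<bar>)"
    using assms by (intro sum.cong refl, subst prod.insert) auto
  then show ?thesis
    using assms by (simp add: d_eta_def sum_pairs_insert)
qed

lemma importance_measure_d_eta: "importance_measure (d_eta M Y)"
proof -
  have no_pairs: "{p. p = {} \<and> card p = 2} = {}" by auto
  show ?thesis
    by (auto simp: importance_measure_def d_eta_def no_pairs intro!: add_nonneg_nonneg sum_nonneg)
qed

theorem theorem4:
  fixes M :: "'a measure" and X :: "'a \<Rightarrow> real^'n::finite"
    and Z :: "'n \<Rightarrow> 'a \<Rightarrow> 'n \<Rightarrow> real"
    and S :: "'n \<Rightarrow> ('n \<Rightarrow> real) set"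
    and r :: "'n \<Rightarrow> real \<Rightarrow> ('n \<Rightarrow> real) \<Rightarrow> ('n \<Rightarrow> real)"
    and Ginv :: "real^'n \<Rightarrow> real^'n^'n"
    and f :: "real^'n \<Rightarrow> real" and Df :: "real^'n \<Rightarrow> real^'n"
  assumes "prob_space M"
    and "X \<in> borel_measurable M"
    and "\<And>j. continuous_rv M (\<lambda>\<omega>. X \<omega> $ j)"
    and "\<And>j. dependency_model M X j (Z j) (S j) (r j)"
    and "\<And>x. generalized_inverse (metric_tensor S r x) (Ginv x)"
    and "weak_gradient f Df"
    and "finite_second_moments M (\<lambda>\<omega>. dep_grad Ginv Df (X \<omega>))"
  shows "importance_measure (d_eta M (\<lambda>\<omega>. dep_grad Ginv Df (X \<omega>))) \<and>
    (\<forall>j. shapley_value (d_eta M (\<lambda>\<omega>. dep_grad Ginv Df (X \<omega>))) j =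
       (LINT \<omega>|M. (axis j 1 \<bullet> dep_grad Ginv Df (X \<omega>))\<^sup>2) +
       1 / 2 * (\<Sum>k\<in>UNIV - {j}. LINT \<omega>|M.
          \<bar>(axis j 1 \<bullet> dep_grad Ginv Df (X \<omega>)) * (axis k 1 \<bullet> dep_grad Ginv Df (X \<omega>))\<bar>))"
  by (simp add: importance_measure_d_eta shapley_value_additive_marginals [OF d_eta_insert])

end
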